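(* Let $n \geq 8$ be an even integer, let $D_{2n} = \langle a, b : a^n = b^2 = 1,\ bab^{-1} = a^{-1} \rangle$, let $H$ be a subgroup of $D_{2n}$, and let $g \in K(H, D_{2n})$. (a) If $H = \langle a \rangle$, then $\Delta_{H,D_{2n}}^g$ is connected and $\operatorname{diam}(\Delta_{H,D_{2n}}^g) = 2$. (b) Let $H = \langle a^{\frac{n}{2}}, a^r b \rangle$ for some $0 \leq r < \frac{n}{2}$. Then $\Delta_{H,D_{2n}}^g$ is connected with diameter $2$ if $g = 1$, and $\Delta_{H,D_{2n}}^g$ is not connected if $g \neq 1$. (c) If $H = \langle a^r b \rangle$ for some $1 \leq r \leq n$, then $\Delta_{H,D_{2n}}^g$ is not connected.
   Context: For a subgroup $H$ of a finite non-abelian group $G$, write $[x,y] = x^{-1}y^{-1}xy$, $Z(H,G) = \{x \in H : xy = yx \text{ for all } y \in G\}$ and $K(H,G) = \{[x,y] : x \in H,\ y \in G\}$. For $g \in G$, $\Delta_{H,G}^g$ is the simple graph with vertex set $G \setminus Z(H,G)$ in which two distinct vertices $x,y$ are adjacent if and only if ($x \in H$ or $y \in H$) and $[x,y] \neq g$ and $[x,y] \neq g^{-1}$. $\operatorname{diam}$ denotes the diameter of a graph. *)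

theory Defs
  imports
    "HOL-Algebra.Generated_Groups"
    "Graph_Theory.Graph_Theory"
begin

section \<open>Groups given by generators and relations\<close>

text \<open>A word is a list of letters; the letter \<open>(x, True)\<close> stands for the generator \<open>x\<close> and
  \<open>(x, False)\<close> for its formal inverse. Every element of the type \<open>'g\<close> is a generator.\<close>

type_synonym 'g word = "('g \<times> bool) list"

text \<open>The least congruence on words that contains the free cancellations and the relations
  \<open>u = v\<close> for \<open>(u, v) \<in> R\<close>.\<close>

inductive word_eq :: "('g word \<times> 'g word) set \<Rightarrow> 'g word \<Rightarrow> 'g word \<Rightarrow> bool"
  for R :: "('g word \<times> 'g word) set" where
  refl: "word_eq R u u"
| sym: "word_eq R u v \<Longrightarrow> word_eq R v u"
| trans: "word_eq R u v \<Longrightarrow> word_eq R v w \<Longrightarrow> word_eq R u w"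
| append: "word_eq R u u' \<Longrightarrow> word_eq R v v' \<Longrightarrow> word_eq R (u @ v) (u' @ v')"
| cancel: "word_eq R [(x, s), (x, \<not> s)] []"
| rel: "(u, v) \<in> R \<Longrightarrow> word_eq R u v"

definition word_class :: "('g word \<times> 'g word) set \<Rightarrow> 'g word \<Rightarrow> 'g word set" where
  "word_class R u = {v. word_eq R u v}"

definition presented_group :: "('g word \<times> 'g word) set \<Rightarrow> 'g word set monoid" where
  "presented_group R =
    \<lparr> carrier = range (word_class R),
      monoid.mult = (\<lambda>A B. {w. \<exists>u\<in>A. \<exists>v\<in>B. word_eq R (u @ v) w}),
      one = word_class R [] \<rparr>"

lemma word_class_eq_iff: "word_class R u = word_class R v \<longleftrightarrow> word_eq R u v"
  unfolding word_class_def
  by (auto intro: word_eq.refl word_eq.sym word_eq.trans)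

lemma presented_group_carrier: "carrier (presented_group R) = range (word_class R)"
  by (simp add: presented_group_def)

lemma presented_group_one: "\<one>\<^bsub>presented_group R\<^esub> = word_class R []"
  by (simp add: presented_group_def)

lemma presented_group_mult:
  "word_class R u \<otimes>\<^bsub>presented_group R\<^esub> word_class R v = word_class R (u @ v)"
  unfolding presented_group_def word_class_def
  by (auto intro: word_eq.refl word_eq.trans word_eq.append)

lemma group_presented_group: "group (presented_group R)"
proof (rule groupI)
  let ?inv = "\<lambda>u :: 'a word. rev (map (\<lambda>(x, s). (x, \<not> s)) u)"
  have inv: "word_eq R (?inv u @ u) []" for u :: "'a word"
  proof (induction u)
    case Nil
    show ?case by (simp add: word_eq.refl)
  next
    case (Cons l u)
    obtain x s where l: "l = (x, s)" by (cases l)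
    have "word_eq R [(x, \<not> s), (x, s)] []"
      using word_eq.cancel[of R x "\<not> s"] by simp
    then have "word_eq R (?inv u @ ([(x, \<not> s), (x, s)] @ u)) (?inv u @ ([] @ u))"
      by (intro word_eq.append word_eq.refl)
    with Cons.IH show ?case
      by (auto simp: l intro: word_eq.trans)
  qed
  fix A assume "A \<in> carrier (presented_group R)"
  then obtain u where u: "A = word_class R u"
    by (auto simp: presented_group_def)
  show "\<exists>B\<in>carrier (presented_group R). B \<otimes>\<^bsub>presented_group R\<^esub> A = \<one>\<^bsub>presented_group R\<^esub>"
  proof
    show "word_class R (?inv u) \<otimes>\<^bsub>presented_group R\<^esub> A = \<one>\<^bsub>presented_group R\<^esub>"
      using inv unfolding u presented_group_mult
      by (simp add: presented_group_def word_class_eq_iff)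
  qed (simp add: presented_group_def)
qed (auto simp: presented_group_carrier presented_group_one presented_group_mult)

section \<open>Dihedral groups\<close>

datatype dihedral_gen = Gen_a | Gen_b

text \<open>The relations \<open>a\<^sup>n = 1\<close>, \<open>b\<^sup>2 = 1\<close> and \<open>b a b\<inverse> = a\<inverse>\<close>.\<close>

definition dihedral_rels :: "nat \<Rightarrow> (dihedral_gen word \<times> dihedral_gen word) set" where
  "dihedral_rels n =
    {(replicate n (Gen_a, True), []),
     (replicate 2 (Gen_b, True), []),
     ([(Gen_b, True), (Gen_a, True), (Gen_b, False)], [(Gen_a, False)])}"

text \<open>The parameter is the order of the rotation: \<open>dihedral n\<close> is the group of order \<open>2n\<close>.\<close>

definition dihedral :: "nat \<Rightarrow> dihedral_gen word set monoid" where
  "dihedral n = presented_group (dihedral_rels n)"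

definition dihedral_a :: "nat \<Rightarrow> dihedral_gen word set" where
  "dihedral_a n = word_class (dihedral_rels n) [(Gen_a, True)]"

definition dihedral_b :: "nat \<Rightarrow> dihedral_gen word set" where
  "dihedral_b n = word_class (dihedral_rels n) [(Gen_b, True)]"

section \<open>Relative centre, commutators and the graph\<close>

definition commutator :: "('a, 'm) monoid_scheme \<Rightarrow> 'a \<Rightarrow> 'a \<Rightarrow> 'a" where
  "commutator G x y = inv\<^bsub>G\<^esub> x \<otimes>\<^bsub>G\<^esub> inv\<^bsub>G\<^esub> y \<otimes>\<^bsub>G\<^esub> x \<otimes>\<^bsub>G\<^esub> y"

definition rel_center :: "'a set \<Rightarrow> ('a, 'm) monoid_scheme \<Rightarrow> 'a set" where
  "rel_center H G = {x \<in> H. \<forall>y\<in>carrier G. x \<otimes>\<^bsub>G\<^esub> y = y \<otimes>\<^bsub>G\<^esub> x}"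

definition rel_commutators :: "'a set \<Rightarrow> ('a, 'm) monoid_scheme \<Rightarrow> 'a set" where
  "rel_commutators H G = {commutator G x y | x y. x \<in> H \<and> y \<in> carrier G}"

text \<open>A simple graph is represented by the symmetric loop-free relation of its adjacent pairs.\<close>

definition Delta :: "'a set \<Rightarrow> ('a, 'm) monoid_scheme \<Rightarrow> 'a \<Rightarrow> 'a pair_pre_digraph" where
  "Delta H G g =
    \<lparr> pverts = carrier G - rel_center H G,
      parcs = {(x, y). x \<in> carrier G - rel_center H G \<and> y \<in> carrier G - rel_center H G \<and>
        x \<noteq> y \<and> (x \<in> H \<or> y \<in> H) \<and> commutator G x y \<noteq> g \<and> commutator G x y \<noteq> inv\<^bsub>G\<^esub> g} \<rparr>"

lemma (in group) inv_commutator: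
  assumes "x \<in> carrier G" "y \<in> carrier G"
  shows "inv (commutator G x y) = commutator G y x"
  using assms by (simp add: commutator_def inv_mult_group m_assoc)

lemma (in group) pair_graph_Delta:
  assumes "finite (carrier G)" "g \<in> carrier G"
  shows "pair_graph (Delta H G g)"
proof
  have "parcs (Delta H G g) \<subseteq> carrier G \<times> carrier G"
    by (auto simp: Delta_def)
  then show "finite (parcs (Delta H G g))"
    using assms(1) by (auto intro: finite_subset)
  have "commutator G y x \<noteq> g \<and> commutator G y x \<noteq> inv g"
    if "x \<in> carrier G" "y \<in> carrier G" "commutator G x y \<noteq> g" "commutator G x y \<noteq> inv g" for x y
    using that assms(2) inv_commutator[of x y] inv_inv
    by (metis commutator_def inv_closed m_closed)
  then show "symmetric (with_proj (Delta H G g))"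
    by (auto simp: symmetric_def sym_def Delta_def)
qed (use assms(1) in \<open>auto simp: Delta_def\<close>)

text \<open>The distance \<open>\<mu>\<close> with all arc weights \<open>1\<close> is the least length of a walk, and \<open>\<infinity>\<close> if there is
  no walk.\<close>

definition diam :: "('a, 'b) pre_digraph \<Rightarrow> ereal" where
  "diam G = (SUP u\<in>verts G. SUP v\<in>verts G. wf_digraph.\<mu> G (\<lambda>_. 1) u v)"

end

theory Submission
  imports Defs "HOL-Number_Theory.Cong"
begin

text \<open>
  Every element of \<open>D\<close> is a rotation \<open>a\<^sup>k\<close> or a reflection \<open>a\<^sup>k b\<close>, with \<open>k\<close> modulo \<open>n\<close>. Two
  rotations commute, and the other commutators are
  \<open>[a\<^sup>i, a\<^sup>j b] = a\<close> to the power \<open>-2i\<close>, \<open>[a\<^sup>i b, a\<^sup>j] = a\<close> to the power \<open>2j\<close> and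
  \<open>[a\<^sup>i b, a\<^sup>j b] = a\<close> to the power \<open>2(i - j)\<close>. So adjacency is a matter of congruences modulo
  \<open>n\<close>, and \<open>g\<close> is always an even power \<open>a\<^sup>c\<close>.

  If \<open>H\<close> consists of the rotations, no two reflections are adjacent, so the diameter is at least
  \<open>2\<close>. For \<open>g = 1\<close> the graph is complete bipartite between the noncentral rotations and the
  reflections. For \<open>g \<noteq> 1\<close> the rotations form a clique, and a rotation \<open>a\<^sup>i\<close> with \<open>2i\<close> different
  from \<open>0\<close>, \<open>c\<close> and \<open>-c\<close> modulo \<open>n\<close> is adjacent to every other vertex; the bound \<open>n \<ge> 8\<close> leaves
  room for one (\<open>Delta_rotations\<close>).

  If \<open>H\<close> contains reflections and only central rotations, every edge has a reflection of \<open>H\<close> as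
  an end. A rotation \<open>a\<^sup>j\<close> outside \<open>H\<close> with \<open>a\<close> to the power \<open>2j\<close> equal to \<open>g\<close> has commutator
  \<open>g\<inverse>\<close> with all of them, so it is isolated (\<open>isolated_rotation_not_connected\<close>). Such a
  \<open>j\<close> exists if \<open>g \<noteq> 1\<close>; it also exists for \<open>g = 1\<close> if \<open>H\<close> has order \<open>2\<close>, namely \<open>n/2\<close>.
  If \<open>H\<close> is the four-group and \<open>g = 1\<close>, each of its two reflections is adjacent to every vertex
  except the other one, which gives diameter \<open>2\<close> (\<open>Delta_Klein_four_one\<close>).

  That the presentation does not collapse is seen from its action on the integers modulo \<open>n\<close>, the
  vertices of the \<open>n\<close>-gon, by \<open>x \<mapsto> x + 1\<close> and \<open>x \<mapsto> -x\<close> (\<open>dihedral_group_dihedral\<close>).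
\<close>

section \<open>Diameter two and isolated vertices\<close>

text \<open>With all weights \<open>1\<close> the cost of a walk is its length. The middle vertices give walks of length
  at most \<open>2\<close> between any two vertices, and the nonadjacent pair \<open>u\<close>, \<open>v\<close> excludes lengths \<open>0\<close>
  and \<open>1\<close>.\<close>

lemma connected_and_diam_eq_2:
  fixes P :: "'a pair_pre_digraph"
  assumes "pair_wf_digraph P"
    and middle: "\<And>x y. x \<in> pverts P \<Longrightarrow> y \<in> pverts P \<Longrightarrow> x \<noteq> y \<Longrightarrow> (x, y) \<notin> parcs P \<Longrightarrow>
      \<exists>z. (x, z) \<in> parcs P \<and> (z, y) \<in> parcs P"
    and far: "u \<in> pverts P" "v \<in> pverts P" "u \<noteq> v" "(u, v) \<notin> parcs P"
  shows "Digraph_Component.connected P \<and> diam P = 2"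
proof
  interpret pair_wf_digraph P by fact
  have walk: "\<exists>p. awalk x p y \<and> length p \<le> 2" if xy: "x \<in> pverts P" "y \<in> pverts P" for x y
  proof -
    consider "x = y" | "(x, y) \<in> parcs P" | z where "(x, z) \<in> parcs P" "(z, y) \<in> parcs P"
      using middle[OF xy] by blast
    then show ?thesis
    proof cases
      case 1
      then have "awalk x [] y" using xy by (simp add: awalk_Nil_iff)
      then show ?thesis by (intro exI conjI) auto
    next
      case 2
      then have "awalk x [(x, y)] y" using xy by (simp add: awalk_simps)
      then show ?thesis by (intro exI conjI) auto
    next
      case 3
      then have "awalk x [(x, z), (z, y)] y" using xy by (auto simp: awalk_simps)
      then show ?thesis by (intro exI conjI) auto
    qed
  qed
  have cost: "awalk_cost (\<lambda>_. 1) p = length p" for p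
    by (induction p) auto
  show "Digraph_Component.connected P"
    unfolding connected_def
  proof (rule strongly_connectedI)
    show "verts (mk_symmetric P) \<noteq> {}"
      using far(1) by auto
  next
    fix x y assume "x \<in> verts (mk_symmetric P)" "y \<in> verts (mk_symmetric P)"
    then obtain p where "awalk x p y"
      using walk by auto
    then show "x \<rightarrow>\<^sup>*\<^bsub>mk_symmetric P\<^esub> y"
      by (intro reachable_mk_symmetricI reachable_awalkI)
  qed
  have le: "\<mu> (\<lambda>_. 1) x y \<le> 2" if xy: "x \<in> pverts P" "y \<in> pverts P" for x y
  proof -
    obtain p where p: "awalk x p y" "length p \<le> 2"
      using walk[OF xy] by blast
    have "\<mu> (\<lambda>_. 1) x y \<le> ereal (real (length p))"
      using min_cost_le_walk_cost[OF p(1), of "\<lambda>_. 1"] by (simp add: cost)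
    also have "\<dots> \<le> 2" using p(2) by simp
    finally show ?thesis .
  qed
  have ge: "2 \<le> \<mu> (\<lambda>_. 1) u v"
    unfolding \<mu>_def
  proof (rule INF_greatest)
    fix p assume "p \<in> {p. awalk u p v}"
    then have p: "awalk u p v" by simp
    have "2 \<le> length p"
    proof (cases p)
      case Nil
      then show ?thesis using p far(3) by (simp add: awalk_Nil_iff)
    next
      case (Cons e q)
      then show ?thesis using p far(4)
        by (cases q) (auto simp: awalk_simps)
    qed
    then show "2 \<le> ereal (awalk_cost (\<lambda>_. 1) p)" by (simp add: cost)
  qed
  show "diam P = 2"
    unfolding diam_def
  proof (rule antisym)
    show "(SUP u\<in>verts P. SUP v\<in>verts P. \<mu> (\<lambda>_. 1) u v) \<le> 2"
      using le by (auto intro!: SUP_least)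
    show "2 \<le> (SUP u\<in>verts P. SUP v\<in>verts P. \<mu> (\<lambda>_. 1) u v)"
      using far(1,2) ge by (intro SUP_upper2[of u] SUP_upper2[of v]) simp_all
  qed
qed

text \<open>Connectedness refers to the symmetric closure, so arcs in both directions have to be
  excluded: a path from \<open>v\<close> to \<open>w\<close> would begin with one of them.\<close>

lemma isolated_vertex_not_connected:
  fixes P :: "'a pair_pre_digraph"
  assumes "v \<in> pverts P" "w \<in> pverts P" "v \<noteq> w"
    and isolated: "\<And>x. (v, x) \<notin> parcs P \<and> (x, v) \<notin> parcs P"
  shows "\<not> Digraph_Component.connected P"
proof
  assume "Digraph_Component.connected P"
  then have "v \<rightarrow>\<^sup>*\<^bsub>mk_symmetric P\<^esub> w"
    using assms(1,2) by (auto simp: connected_def)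
  then obtain x where "(v, x) \<in> parcs (mk_symmetric P)"
    using assms(3) by (cases rule: pre_digraph.converse_reachable_cases) auto
  then show False
    using isolated by (auto simp: parcs_mk_symmetric)
qed

context group
begin

lemma pair_wf_digraph_Delta: "pair_wf_digraph (Delta H G g)"
  by unfold_locales (auto simp: Delta_def)

text \<open>Exchanging \<open>x\<close> and \<open>y\<close> inverts the commutator, and the excluded set \<open>{g, g\<inverse>}\<close> is closed
  under inversion.\<close>

lemma parcs_Delta_commute:
  assumes "g \<in> carrier G" "(x, y) \<in> parcs (Delta H G g)"
  shows "(y, x) \<in> parcs (Delta H G g)"
proof -
  have "x \<in> carrier G" "y \<in> carrier G"
    using assms(2) by (auto simp: Delta_def)
  then have "commutator G x y = inv (commutator G y x)" "commutator G y x \<in> carrier G"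
    by (auto simp: inv_commutator) (simp add: commutator_def)
  then show ?thesis
    using assms by (auto simp: Delta_def)
qed

end

section \<open>Rotations and reflections\<close>

text \<open>This provides a rotation \<open>a\<^sup>i\<close> that is not central and whose commutators with the reflections
  are different from \<open>a\<^sup>c\<close> and its inverse.\<close>

lemma exists_double_avoiding:
  fixes n c :: int
  assumes "n \<ge> 8"
  shows "\<exists>i. \<not> n dvd 2 * i \<and> \<not> n dvd 2 * i - c \<and> \<not> n dvd 2 * i + c"
proof (rule ccontr)
  \<comment> \<open>The numbers \<open>2\<close>, \<open>4\<close>, \<open>6\<close> are not divisible by \<open>n\<close>, so each of them would have to be
    congruent to \<open>c\<close> or \<open>-c\<close>; but they lie in three different residue classes.\<close>
  assume contra: "\<nexists>i. \<not> n dvd 2 * i \<and> \<not> n dvd 2 * i - c \<and> \<not> n dvd 2 * i + c"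
  have small: "\<not> n dvd k" if "0 < k" "k < 8" for k
    using that assms zdvd_not_zless by auto
  have apart: "\<not> (n dvd i + e \<and> n dvd j + e)" if "0 < i - j" "i - j < 8" for i j e
    using small[OF that] dvd_diff[of n "i + e" "j + e"] by auto
  have "n dvd k - c \<or> n dvd k + c" if "k = 2 \<or> k = 4 \<or> k = 6" for k
    using that contra[simplified, rule_format, of 1] contra[simplified, rule_format, of 2]
      contra[simplified, rule_format, of 3] small[of 2] small[of 4] small[of 6]
    by auto
  from this[of 2] this[of 4] this[of 6]
  show False
    using apart[of 4 2 c] apart[of 6 2 c] apart[of 6 4 c]
      apart[of 4 2 "- c"] apart[of 6 2 "- c"] apart[of 6 4 "- c"]
    by auto
qed

text \<open>The exponents range over all integers, and \<open>n\<close> is an integer too, so that the multiplication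
  laws hold without truncation or reduction and equality of elements becomes divisibility by \<open>n\<close>.\<close>

locale dihedral_group = group G for G (structure) +
  fixes a b :: 'a and n :: int
  assumes a_closed [simp]: "a \<in> carrier G"
    and b_closed [simp]: "b \<in> carrier G"
    and b_square: "b \<otimes> b = \<one>"
    and b_conj_a: "b \<otimes> a \<otimes> inv b = inv a"
    and a_int_pow_eq_one_iff: "a [^] (k::int) = \<one> \<longleftrightarrow> n dvd k"
    and b_not_a_int_pow: "b \<noteq> a [^] (k::int)"
    and generated: "carrier G = generate G {a, b}"
begin

definition rot :: "int \<Rightarrow> 'a" where
  "rot k = a [^] k"

definition ref :: "int \<Rightarrow> 'a" where
  "ref k = a [^] k \<otimes> b"

lemma rot_closed [simp]: "rot k \<in> carrier G"
  by (simp add: rot_def)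

lemma ref_closed [simp]: "ref k \<in> carrier G"
  by (simp add: ref_def)

lemma one_eq_rot: "\<one> = rot 0"
  by (simp add: rot_def)

lemma rot_mult_rot: "rot i \<otimes> rot j = rot (i + j)"
  by (simp add: rot_def int_pow_mult)

text \<open>Conjugation by \<open>b\<close> is a homomorphism, so it inverts all powers of \<open>a\<close> as soon as it inverts
  \<open>a\<close>.\<close>

lemma b_mult_rot: "b \<otimes> rot k = rot (- k) \<otimes> b"
proof -
  have hom: "(\<lambda>x. b \<otimes> x \<otimes> inv b) \<in> hom G G"
    by (rule homI) (simp_all add: m_assoc inv_solve_left)
  interpret conj: group_hom G G "\<lambda>x. b \<otimes> x \<otimes> inv b"
    by unfold_locales (rule hom)
  have "b \<otimes> rot k \<otimes> inv b = inv a [^] k"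
    using conj.hom_int_pow[of a k] by (simp add: rot_def b_conj_a)
  also have "\<dots> = rot (- k)"
    by (simp add: rot_def int_pow_inv int_pow_neg)
  finally have "b \<otimes> rot k \<otimes> inv b \<otimes> b = rot (- k) \<otimes> b"
    by simp
  then show ?thesis
    by (simp add: m_assoc)
qed

lemma ref_eq: "ref k = rot k \<otimes> b"
  by (simp add: rot_def ref_def)

lemma rot_mult_ref: "rot i \<otimes> ref j = ref (i + j)"
  by (simp add: ref_eq m_assoc[symmetric] rot_mult_rot)

lemma ref_mult_rot: "ref i \<otimes> rot j = ref (i - j)"
  using rot_mult_ref[of i "- j"] by (simp add: ref_eq m_assoc b_mult_rot)

lemma ref_mult_ref: "ref i \<otimes> ref j = rot (i - j)"
proof -
  have "ref i \<otimes> ref j = (ref i \<otimes> rot j) \<otimes> b"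
    by (simp add: ref_eq[of j] m_assoc)
  also have "\<dots> = rot (i - j) \<otimes> (b \<otimes> b)"
    unfolding ref_mult_rot by (simp add: ref_eq m_assoc)
  finally show ?thesis
    by (simp add: b_square)
qed

lemma inv_rot: "inv (rot k) = rot (- k)"
  by (simp add: rot_def int_pow_neg)

lemma inv_ref: "inv (ref k) = ref k"
  by (intro inv_equality) (simp_all add: ref_mult_ref one_eq_rot)

lemmas dihedral_mult = rot_mult_rot rot_mult_ref ref_mult_rot ref_mult_ref inv_rot inv_ref

lemma rot_eq_rot_iff: "rot i = rot j \<longleftrightarrow> n dvd i - j"
proof -
  have "rot i = rot j \<longleftrightarrow> rot i \<otimes> inv (rot j) = \<one>"
    by (metis inv_equality inv_inv inv_closed r_inv rot_closed)
  also have "\<dots> \<longleftrightarrow> n dvd i - j"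
    by (simp add: dihedral_mult) (simp add: rot_def a_int_pow_eq_one_iff)
  finally show ?thesis .
qed

lemma ref_eq_ref_iff: "ref i = ref j \<longleftrightarrow> n dvd i - j"
  by (simp add: ref_eq rot_eq_rot_iff)

lemma rot_neq_ref: "rot i \<noteq> ref j"
proof
  assume "rot i = ref j"
  then have "b = rot (- j) \<otimes> rot i"
    by (metis ref_eq inv_rot inv_solve_left rot_closed b_closed)
  then have "b = rot (i - j)"
    by (simp add: dihedral_mult)
  then show False
    using b_not_a_int_pow by (simp add: rot_def)
qed

lemmas dihedral_eq = rot_eq_rot_iff ref_eq_ref_iff rot_neq_ref rot_neq_ref[symmetric]

lemma generate_a: "generate G {a} = range rot"
  by (simp add: generate_pow) (auto simp: rot_def[abs_def])

text \<open>For \<open>d\<close> dividing \<open>n\<close> this is the dihedral group of the regular polygon with \<open>n/d\<close> vertices,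
  with a reflection axis chosen by \<open>r\<close>. The case \<open>d = n/2\<close> gives the four-group and \<open>d = n\<close> the
  group of order \<open>2\<close>.\<close>

definition dihedral_subgroup :: "int \<Rightarrow> int \<Rightarrow> 'a set" where
  "dihedral_subgroup d r = {rot k | k. d dvd k} \<union> {ref k | k. d dvd k - r}"

lemma generate_rot_ref: "generate G {rot d, ref r} = dihedral_subgroup d r"
proof
  have dvd_step: "d dvd i + j - r" if "d dvd i" "d dvd j - r" for i j
    using dvd_add[OF that] by (simp add: algebra_simps)
  show "generate G {rot d, ref r} \<subseteq> dihedral_subgroup d r"
  proof
    fix x assume "x \<in> generate G {rot d, ref r}"
    then show "x \<in> dihedral_subgroup d r"
    proof induction
      case one
      show ?case by (auto simp: dihedral_subgroup_def one_eq_rot)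
    next
      case (incl h)
      then show ?case by (auto simp: dihedral_subgroup_def)
    next
      case (inv h)
      then have "inv h = rot (- d) \<or> inv h = ref r"
        by (auto simp: dihedral_mult)
      then show ?case by (auto simp: dihedral_subgroup_def)
    next
      case (eng x y)
      consider i j where "x = rot i" "y = rot j" "d dvd i" "d dvd j"
        | i j where "x = rot i" "y = ref j" "d dvd i" "d dvd j - r"
        | i j where "x = ref i" "y = rot j" "d dvd i - r" "d dvd j"
        | i j where "x = ref i" "y = ref j" "d dvd i - r" "d dvd j - r"
        using eng.IH by (auto simp: dihedral_subgroup_def)
      then show ?case
      proof cases
        case 1
        then show ?thesis by (auto simp: dihedral_subgroup_def dihedral_mult)
      next
        case 2
        then show ?thesis by (auto simp: dihedral_subgroup_def dihedral_mult intro: dvd_step)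
      next
        case 3
        then have "d dvd i - j - r" using dvd_diff[of d "i - r" j] by (simp add: algebra_simps)
        with 3 show ?thesis by (auto simp: dihedral_subgroup_def dihedral_mult)
      next
        case 4
        then have "d dvd i - j" using dvd_diff[of d "i - r" "j - r"] by simp
        with 4 show ?thesis by (auto simp: dihedral_subgroup_def dihedral_mult)
      qed
    qed
  qed
  have sub: "subgroup (generate G {rot d, ref r}) G"
    by (simp add: generate_is_subgroup)
  have rot: "rot k \<in> generate G {rot d, ref r}" if dk: "d dvd k" for k
  proof -
    obtain q where "k = d * q" using dk by (rule dvdE)
    then have "rot k = rot d [^] q"
      by (simp add: rot_def int_pow_pow)
    then show ?thesis
      using sub by (simp add: subgroup_int_pow_closed generate.incl)
  qed
  have ref: "ref k \<in> generate G {rot d, ref r}" if "d dvd k - r" for k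
  proof -
    have "ref k = rot (k - r) \<otimes> ref r"
      by (simp add: dihedral_mult)
    then show ?thesis
      using rot[OF that] by (simp add: generate.eng generate.incl)
  qed
  show "dihedral_subgroup d r \<subseteq> generate G {rot d, ref r}"
    using rot ref by (auto simp: dihedral_subgroup_def)
qed

lemma generate_ref: "generate G {ref r} = dihedral_subgroup n r"
proof -
  have "rot n = \<one>"
    by (simp add: one_eq_rot dihedral_eq)
  then have "generate G {rot n, ref r} = generate G {ref r}"
    by (intro equalityI generate_subgroup_incl mono_generate generate_is_subgroup)
      (auto intro: generate.one generate.incl)
  then show ?thesis
    by (simp add: generate_rot_ref)
qed

text \<open>An element determines its exponent only modulo \<open>n\<close>; the hypothesis \<open>d dvd n\<close> makes
  divisibility by \<open>d\<close> independent of the choice.\<close>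

lemma rot_in_dihedral_subgroup_iff:
  assumes "d dvd n"
  shows "rot k \<in> dihedral_subgroup d r \<longleftrightarrow> d dvd k"
proof -
  have "d dvd k" if "n dvd k - i" "d dvd i" for i
    using dvd_add[OF dvd_trans[OF assms that(1)] that(2)] by simp
  then show ?thesis
    by (auto simp: dihedral_subgroup_def dihedral_eq intro: exI[of _ k])
qed

lemma ref_in_dihedral_subgroup_iff:
  assumes "d dvd n"
  shows "ref k \<in> dihedral_subgroup d r \<longleftrightarrow> d dvd k - r"
proof -
  have "d dvd k - r" if "n dvd k - i" "d dvd i - r" for i
    using dvd_add[OF dvd_trans[OF assms that(1)] that(2)] by simp
  then show ?thesis
    by (auto simp: dihedral_subgroup_def dihedral_eq intro: exI[of _ k])
qed

text \<open>The whole group is the case \<open>d = 1\<close>, \<open>r = 0\<close> of a generated dihedral subgroup.\<close>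

lemma carrier_eq: "carrier G = range rot \<union> range ref"
proof -
  have "rot 1 = a" "ref 0 = b"
    by (simp_all add: rot_def ref_def)
  then show ?thesis
    using generate_rot_ref[of 1 0] generated by (auto simp: dihedral_subgroup_def)
qed

lemma in_carrierE:
  assumes "x \<in> carrier G"
  obtains k where "x = rot k" | k where "x = ref k"
  using assms by (auto simp: carrier_eq)

lemma commutator_rot_rot: "commutator G (rot i) (rot j) = \<one>"
  and commutator_rot_ref: "commutator G (rot i) (ref j) = rot (2 * - i)"
  and commutator_ref_rot: "commutator G (ref i) (rot j) = rot (2 * j)"
  and commutator_ref_ref: "commutator G (ref i) (ref j) = rot (2 * (i - j))"
  by (simp_all add: commutator_def dihedral_mult one_eq_rot algebra_simps)

lemmas dihedral_commutator =
  commutator_rot_rot commutator_rot_ref commutator_ref_rot commutator_ref_ref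

lemma rel_commutatorsE:
  assumes "g \<in> rel_commutators H G" "H \<subseteq> carrier G"
  obtains k where "g = rot (2 * k)"
proof -
  obtain x y where g: "g = commutator G x y" and "x \<in> carrier G" "y \<in> carrier G"
    using assms by (auto simp: rel_commutators_def)
  have "\<one> = rot (2 * 0)"
    by (simp add: one_eq_rot)
  with \<open>x \<in> carrier G\<close> \<open>y \<in> carrier G\<close> have "\<exists>k. g = rot (2 * k)"
    by (elim in_carrierE) (simp_all only: g dihedral_commutator, blast+)
  then show ?thesis using that by blast
qed

lemma rot_in_rel_center_iff: "rot k \<in> rel_center H G \<longleftrightarrow> rot k \<in> H \<and> n dvd 2 * k"
proof -
  have "rot k \<otimes> ref i = ref i \<otimes> rot k \<longleftrightarrow> n dvd 2 * k" for i
    by (simp add: dihedral_mult dihedral_eq)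
  moreover have "rot k \<otimes> rot i = rot i \<otimes> rot k" for i
    by (simp add: dihedral_mult add.commute)
  ultimately have "(\<forall>y \<in> carrier G. rot k \<otimes> y = y \<otimes> rot k) \<longleftrightarrow> n dvd 2 * k"
    unfolding carrier_eq by blast
  then show ?thesis
    by (simp add: rel_center_def)
qed

text \<open>A reflection does not even commute with \<open>a\<close>: their commutator is \<open>a\<^sup>2\<close>.\<close>

lemma ref_notin_rel_center:
  assumes "\<not> n dvd 2"
  shows "ref k \<notin> rel_center H G"
proof
  assume "ref k \<in> rel_center H G"
  then have "ref k \<otimes> rot 1 = rot 1 \<otimes> ref k"
    by (auto simp: rel_center_def)
  then show False
    using assms by (simp add: dihedral_mult dihedral_eq)
qed

section \<open>Graphs of the rotation subgroup and of dihedral subgroups\<close>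

text \<open>For \<open>g = 1\<close> the graph is complete bipartite; for \<open>g \<noteq> 1\<close> some rotation is adjacent to all other
  vertices.\<close>

theorem Delta_rotations:
  assumes n: "n \<ge> 8" and H: "H = range rot" and g: "g \<in> rel_commutators H G"
  shows "Digraph_Component.connected (Delta H G g) \<and> diam (Delta H G g) = 2"
proof -
  have n2: "\<not> n dvd 2"
    using n zdvd_not_zless by auto
  have H_sub: "H \<subseteq> carrier G"
    by (auto simp: H)
  obtain c where c: "g = rot c"
    using rel_commutatorsE[OF g H_sub] by blast
  have [simp]: "rot k \<in> H" "ref k \<notin> H" for k
    by (auto simp: H dihedral_eq)
  have rot_vertex: "rot k \<in> pverts (Delta H G g) \<longleftrightarrow> \<not> n dvd 2 * k" for k
    by (simp add: Delta_def rot_in_rel_center_iff)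
  have ref_vertex: "ref k \<in> pverts (Delta H G g)" for k
    by (simp add: Delta_def ref_notin_rel_center[OF n2])
  note adj_commute = parcs_Delta_commute[of g _ _ H]
  have g_closed: "g \<in> carrier G" by (simp add: c)
  have rot_ref: "(rot i, ref j) \<in> parcs (Delta H G g)"
    if "\<not> n dvd 2 * i" "\<not> n dvd 2 * i - c" "\<not> n dvd 2 * i + c" for i j
  proof -
    have "n dvd - (2 * i) - c \<longleftrightarrow> n dvd 2 * i + c" "n dvd c - 2 * i \<longleftrightarrow> n dvd 2 * i - c"
      using dvd_minus_iff[of n "2 * i + c"] by (simp_all add: dvd_diff_commute)
    then show ?thesis
      using that rot_vertex[of i] ref_vertex[of j]
      by (simp add: Delta_def dihedral_commutator c inv_rot dihedral_eq)
  qed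
  show ?thesis
  proof (rule connected_and_diam_eq_2[OF pair_wf_digraph_Delta])
    show "ref 0 \<in> pverts (Delta H G g)" "ref 1 \<in> pverts (Delta H G g)"
      by (fact ref_vertex)+
    show "ref 0 \<noteq> ref 1"
      using n by (simp add: dihedral_eq)
    show "(ref 0, ref 1) \<notin> parcs (Delta H G g)"
      by (simp add: Delta_def)
  next
    fix x y assume x: "x \<in> pverts (Delta H G g)" and y: "y \<in> pverts (Delta H G g)"
      and xy: "x \<noteq> y" "(x, y) \<notin> parcs (Delta H G g)"
    have xy_closed: "x \<in> carrier G" "y \<in> carrier G"
      using x y by (auto simp: Delta_def)
    obtain i where i: "\<not> n dvd 2 * i" "\<not> n dvd 2 * i - c" "\<not> n dvd 2 * i + c"
      using exists_double_avoiding[OF n] by blast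
    show "\<exists>z. (x, z) \<in> parcs (Delta H G g) \<and> (z, y) \<in> parcs (Delta H G g)"
    proof (cases "g = \<one>")
      case True
      then have "n dvd c" by (simp add: c one_eq_rot dihedral_eq)
      \<comment> \<open>With \<open>c\<close> congruent to \<open>0\<close>, every noncentral rotation avoids \<open>c\<close> and \<open>-c\<close>.\<close>
      then have bip: "(rot k, ref j) \<in> parcs (Delta H G g)" if "\<not> n dvd 2 * k" for k j
        using that by (intro rot_ref) (auto simp: dvd_add_left_iff dvd_diff_left_iff)
      then have bip': "(ref j, rot k) \<in> parcs (Delta H G g)" if "\<not> n dvd 2 * k" for k j
        using that adj_commute[OF g_closed] by blast
      show ?thesis
        using xy_closed
        by (elim in_carrierE) (use bip bip' x y xy i(1) rot_vertex in blast)+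
    next
      case False
      \<comment> \<open>Rotations commute, so they are adjacent to each other now, and \<open>rot i\<close> was chosen to be
        adjacent to every reflection.\<close>
      have univ: "(rot i, z) \<in> parcs (Delta H G g)" 
        if z: "z \<in> pverts (Delta H G g)" "z \<noteq> rot i" for z
      proof -
        have "z \<in> carrier G" using z by (simp add: Delta_def)
        then show ?thesis
        proof (cases rule: in_carrierE)
          case (1 k)
          have "\<one> \<noteq> inv g" using False g_closed by (metis inv_inv inv_one)
          then show ?thesis using 1 z i(1) rot_vertex False
            by (auto simp: Delta_def commutator_rot_rot rot_in_rel_center_iff)
        next
          case (2 k)
          then show ?thesis using rot_ref i by blast
        qed
      qed
      have "rot i \<noteq> x" "rot i \<noteq> y" 
        using univ x y xy adj_commute[OF g_closed] by blast+
      then show ?thesis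
        using univ x y adj_commute[OF g_closed] by blast
    qed
  qed
qed

text \<open>The condition \<open>n dvd 2 * d\<close> says that all rotations in \<open>H\<close> are central, so they are not
  vertices. Since \<open>a\<^sup>j\<close> lies outside \<open>H\<close>, a neighbour would have to be a reflection in \<open>H\<close>; but
  the commutator of \<open>a\<^sup>j\<close> with any reflection is \<open>g\<inverse>\<close>.\<close>

lemma isolated_rotation_not_connected:
  assumes d: "d dvd n" "n dvd 2 * d" and n2: "\<not> n dvd 2"
    and j: "\<not> d dvd j" and g: "g = rot (2 * j)"
  shows "\<not> Digraph_Component.connected (Delta (dihedral_subgroup d r) G g)"
proof -
  let ?H = "dihedral_subgroup d r"
  have rotH: "rot j \<notin> ?H"
    using j by (simp add: rot_in_dihedral_subgroup_iff[OF d(1)])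
  have no_arc: "(rot j, x) \<notin> parcs (Delta ?H G g)" for x
  proof
    assume arc: "(rot j, x) \<in> parcs (Delta ?H G g)"
    then have x: "x \<in> carrier G" "x \<in> ?H" "x \<notin> rel_center ?H G"
      using rotH by (auto simp: Delta_def)
    from x(1) show False
    proof (cases rule: in_carrierE)
      case (1 k)
      then have "d dvd k"
        using x(2) by (simp add: rot_in_dihedral_subgroup_iff[OF d(1)])
      then have "n dvd 2 * k"
        using d(2) by (meson dvd_trans dvd_triv_left mult_dvd_mono dvd_refl)
      then show False
        using x 1 by (simp add: rot_in_rel_center_iff)
    next
      case (2 k)
      then show False
        using arc by (simp add: Delta_def commutator_rot_ref g inv_rot)
    qed
  qed
  show ?thesis
  proof (rule isolated_vertex_not_connected)
    show "rot j \<in> pverts (Delta ?H G g)"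
      using rotH by (simp add: Delta_def rot_in_rel_center_iff)
    show "ref r \<in> pverts (Delta ?H G g)"
      by (simp add: Delta_def ref_notin_rel_center[OF n2])
    show "rot j \<noteq> ref r"
      by (rule rot_neq_ref)
    show "(rot j, x) \<notin> parcs (Delta ?H G g) \<and> (x, rot j) \<notin> parcs (Delta ?H G g)" for x
      using no_arc parcs_Delta_commute[of g x "rot j" ?H] by (auto simp: g)
  qed
qed

text \<open>Here \<open>H\<close> is the four-group \<open>{1, a\<^sup>m, a\<^sup>r b, z}\<close> with \<open>z = a\<^sup>m a\<^sup>r b\<close>, and adjacency means not
  commuting. The centraliser of either reflection is \<open>H\<close>, so each is joined to all vertices outside
  \<open>H\<close>. The two reflections commute and have the middle vertex \<open>a\<close>; two vertices outside \<open>H\<close> have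
  the middle vertex \<open>a\<^sup>r b\<close>.\<close>

theorem Delta_Klein_four_one:
  assumes n: "n = 2 * m" "n \<ge> 4"
  shows "Digraph_Component.connected (Delta (dihedral_subgroup m r) G \<one>) \<and>
    diam (Delta (dihedral_subgroup m r) G \<one>) = 2"
proof -
  let ?H = "dihedral_subgroup m r"
  let ?P = "Delta ?H G \<one>"
  have n2: "\<not> n dvd 2" and m1: "\<not> m dvd 1"
    using n zdvd_not_zless by auto
  have m: "m dvd n" "n dvd 2 * m"
    using n(1) by auto
  have n_iff: "n dvd 2 * k \<longleftrightarrow> m dvd k" for k
    by (simp add: n(1))
  have rot_vertex: "rot k \<in> pverts ?P \<longleftrightarrow> \<not> m dvd k" for k
    by (auto simp: Delta_def rot_in_rel_center_iff n_iff rot_in_dihedral_subgroup_iff[OF m(1)])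
  have ref_vertex: "ref k \<in> pverts ?P" for k
    by (simp add: Delta_def ref_notin_rel_center[OF n2])
  have join: "(x, ref k) \<in> parcs ?P" "(ref k, x) \<in> parcs ?P"
    if x: "x \<in> pverts ?P" "x \<notin> ?H" and k: "ref k \<in> ?H" for x k
  proof -
    have "x \<in> carrier G"
      using x by (simp add: Delta_def)
    then have "commutator G x (ref k) \<noteq> \<one>"
    proof (cases rule: in_carrierE)
      case (1 i)
      then show ?thesis
        using x rot_vertex
        by (simp add: commutator_rot_ref one_eq_rot dihedral_eq n_iff)
    next
      case (2 i)
      have "m dvd i - r" if "m dvd i - k"
        using dvd_add[OF that, of "k - r"] k by (simp add: ref_in_dihedral_subgroup_iff[OF m(1)])
      then have "\<not> m dvd i - k"
        using x 2 by (auto simp: ref_in_dihedral_subgroup_iff[OF m(1)])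
      then show ?thesis
        using n_iff[of "i - k"] 2 by (simp add: commutator_ref_ref one_eq_rot dihedral_eq)
    qed
    then show "(x, ref k) \<in> parcs ?P"
      using x k ref_vertex[of k] by (auto simp: Delta_def)
    then show "(ref k, x) \<in> parcs ?P"
      by (rule parcs_Delta_commute[rotated]) simp
  qed
  have vertex_in_H: "\<exists>k. x = ref k" if x: "x \<in> pverts ?P" "x \<in> ?H" for x
  proof -
    have "x \<in> carrier G" using x by (simp add: Delta_def)
    then show ?thesis
      using x rot_vertex rot_in_dihedral_subgroup_iff[OF m(1)] by (auto elim: in_carrierE)
  qed
  have rot1: "rot 1 \<in> pverts ?P" "rot 1 \<notin> ?H"
    using m1 by (auto simp: rot_vertex rot_in_dihedral_subgroup_iff[OF m(1)])
  have refr: "ref r \<in> ?H"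
    by (simp add: ref_in_dihedral_subgroup_iff[OF m(1)])
  show ?thesis
  proof (rule connected_and_diam_eq_2[OF pair_wf_digraph_Delta])
    show "ref r \<in> pverts ?P" "ref (r + m) \<in> pverts ?P"
      by (fact ref_vertex)+
    show "ref r \<noteq> ref (r + m)"
      using n by (auto simp: dihedral_eq dest: zdvd_imp_le)
    show "(ref r, ref (r + m)) \<notin> parcs ?P"
      by (simp add: Delta_def commutator_ref_ref one_eq_rot dihedral_eq n(1))
  next
    fix x y assume x: "x \<in> pverts ?P" and y: "y \<in> pverts ?P" and "x \<noteq> y"
      and nonadj: "(x, y) \<notin> parcs ?P"
    show "\<exists>z. (x, z) \<in> parcs ?P \<and> (z, y) \<in> parcs ?P"
    proof (cases "x \<in> ?H")
      case True
      then have "y \<in> ?H" using nonadj join(2)[OF y] vertex_in_H[OF x] by blast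
      then show ?thesis
        using True vertex_in_H x y join[OF rot1] by blast
    next
      case False
      then have "y \<notin> ?H" using nonadj join(1)[OF x] vertex_in_H[OF y] by blast
      then show ?thesis
        using False join(1)[OF x _ refr] join(2)[OF y _ refr] by blast
    qed
  qed
qed

end

section \<open>The presented dihedral group acts on a polygon\<close>

text \<open>The number \<open>x\<close> stands for the vertex \<open>x\<close> modulo \<open>n\<close> of a regular \<open>n\<close>-gon. Acting on all
  integers gives one action for all \<open>n\<close>; the relations then hold only up to congruence.\<close>

fun letter_act :: "dihedral_gen \<times> bool \<Rightarrow> int \<Rightarrow> int" where
  "letter_act (Gen_a, s) x = (if s then x + 1 else x - 1)"
| "letter_act (Gen_b, s) x = - x"

abbreviation polygon_act :: "dihedral_gen word \<Rightarrow> int \<Rightarrow> int" where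
  "polygon_act w x \<equiv> foldr letter_act w x"

lemma polygon_act_cong:
  "[x = y] (mod m) \<Longrightarrow> [polygon_act w x = polygon_act w y] (mod m)"
proof (induction w)
  case (Cons l w)
  obtain z s where "l = (z, s)" by (cases l)
  with Cons show ?case
    by (cases z) (auto intro: cong_add cong_diff simp: cong_minus_minus_iff)
qed simp

lemma polygon_act_replicate:
  "polygon_act (replicate k (Gen_a, s)) x = (if s then x + int k else x - int k)"
  by (induction k) auto

text \<open>The congruence is needed for all \<open>x\<close> at once: in a concatenation the left word acts on the
  image of \<open>x\<close> under the right one.\<close>

lemma word_eq_imp_polygon_act_cong:
  assumes "word_eq (dihedral_rels n) u v"
  shows "[polygon_act u x = polygon_act v x] (mod int n)"
  using assms
proof (induction arbitrary: x)
  case (sym u v)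
  then show ?case using cong_sym by blast
next
  case (trans u v w)
  then show ?case using cong_trans by blast
next
  case (append u u' v v')
  have "[polygon_act u (polygon_act v x) = polygon_act u (polygon_act v' x)] (mod int n)"
    by (rule polygon_act_cong) (rule append.IH)
  also have "[polygon_act u (polygon_act v' x) = polygon_act u' (polygon_act v' x)] (mod int n)"
    by (rule append.IH)
  finally show ?case by simp
next
  case (cancel z s)
  show ?case by (cases z) auto
next
  case (rel u v)
  then show ?case
    by (auto simp: dihedral_rels_def polygon_act_replicate cong_def numeral_2_eq_2
        simp del: foldr_replicate)
qed simp

text \<open>The relations give all laws except the two that separate elements. These come from the action:
  \<open>a\<^sup>k\<close> moves \<open>0\<close> to \<open>k\<close>, so it is trivial only if \<open>n\<close> divides \<open>k\<close>. And \<open>b\<close> fixes \<open>0\<close> but moves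
  \<open>1\<close> to \<open>-1\<close>, while a translation fixing \<open>0\<close> fixes \<open>1\<close>, so \<open>b\<close> is no power of \<open>a\<close> unless
  \<open>n\<close> divides \<open>2\<close>.\<close>

lemma dihedral_group_dihedral:
  assumes "n \<ge> 3"
  shows "dihedral_group (dihedral n) (dihedral_a n) (dihedral_b n) (int n)"
proof -
  define D where "D = dihedral n"
  define a where "a = dihedral_a n"
  define b where "b = dihedral_b n"
  let ?cl = "word_class (dihedral_rels n)"
  interpret group D
    unfolding D_def dihedral_def by (rule group_presented_group)
  have carrier: "carrier D = range ?cl"
    by (simp add: D_def dihedral_def presented_group_carrier)
  have one: "\<one>\<^bsub>D\<^esub> = ?cl []"
    by (simp add: D_def dihedral_def presented_group_one)
  have mult: "?cl u \<otimes>\<^bsub>D\<^esub> ?cl v = ?cl (u @ v)" for u v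
    by (simp add: D_def dihedral_def presented_group_mult)
  have cl_closed: "?cl u \<in> carrier D" for u
    by (simp add: carrier)
  have a: "a = ?cl [(Gen_a, True)]" and b: "b = ?cl [(Gen_b, True)]"
    by (simp_all add: a_def b_def dihedral_a_def dihedral_b_def)
  have a_closed: "a \<in> carrier D" and b_closed: "b \<in> carrier D"
    by (simp_all add: a b cl_closed)
  have inv_letter: "?cl [(z, False)] = inv\<^bsub>D\<^esub> (?cl [(z, True)])" for z
    by (intro inv_equality[symmetric] cl_closed)
      (use word_eq.cancel[of _ z False] in \<open>simp add: mult one word_class_eq_iff\<close>)
  have rels: "?cl u = ?cl v" if "(u, v) \<in> dihedral_rels n" for u v
    using that by (simp add: word_class_eq_iff word_eq.rel)
  have replicate: "?cl (replicate k l) = ?cl [l] [^]\<^bsub>D\<^esub> k" for k :: nat and l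
  proof (induction k)
    case (Suc k)
    have "?cl (replicate (Suc k) l) = ?cl (replicate k l) \<otimes>\<^bsub>D\<^esub> ?cl [l]"
      by (simp add: mult replicate_append_same)
    then show ?case by (simp add: Suc)
  qed (simp add: one)
  have "?cl (replicate n (Gen_a, True)) = ?cl []"
    by (rule rels) (simp add: dihedral_rels_def)
  then have a_pow_n: "a [^]\<^bsub>D\<^esub> n = \<one>\<^bsub>D\<^esub>"
    by (simp add: replicate a one)
  have "?cl (replicate 2 (Gen_b, True)) = ?cl []"
    by (rule rels) (simp add: dihedral_rels_def)
  then have bb: "b \<otimes>\<^bsub>D\<^esub> b = \<one>\<^bsub>D\<^esub>"
    by (simp add: numeral_2_eq_2 b one mult)
  have "?cl [(Gen_b, True), (Gen_a, True), (Gen_b, False)] = ?cl [(Gen_a, False)]"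
    by (rule rels) (simp add: dihedral_rels_def)
  then have conj: "b \<otimes>\<^bsub>D\<^esub> a \<otimes>\<^bsub>D\<^esub> inv\<^bsub>D\<^esub> b = inv\<^bsub>D\<^esub> a"
    by (simp add: a b mult inv_letter[symmetric])
  have int_pow: "a [^]\<^bsub>D\<^esub> (k::int) = ?cl (replicate (nat \<bar>k\<bar>) (Gen_a, 0 \<le> k))" for k
  proof (cases "0 \<le> k")
    case True
    then have "a [^]\<^bsub>D\<^esub> k = a [^]\<^bsub>D\<^esub> nat k"
      by (metis int_pow_int nat_0_le)
    with True show ?thesis
      by (simp add: replicate a)
  next
    case False
    then obtain j where k: "k = - int j"
      by (metis nat_0_le neg_le_0_iff_le linear minus_minus)
    have "a [^]\<^bsub>D\<^esub> k = (inv\<^bsub>D\<^esub> a) [^]\<^bsub>D\<^esub> j"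
      using int_pow_neg_int[OF a_closed, of j] a_closed by (simp add: nat_pow_inv k)
    with False show ?thesis
      by (simp add: replicate a inv_letter k)
  qed
  have act_int_pow: "polygon_act (replicate (nat \<bar>k\<bar>) (Gen_a, 0 \<le> k)) x = x + k" for k x
    by (auto simp: polygon_act_replicate simp del: foldr_replicate)
  have "dihedral_group D a b (int n)"
  proof
    show "a [^]\<^bsub>D\<^esub> k = \<one>\<^bsub>D\<^esub> \<longleftrightarrow> int n dvd k" for k :: int
    proof
      assume "a [^]\<^bsub>D\<^esub> k = \<one>\<^bsub>D\<^esub>"
      then have "word_eq (dihedral_rels n) (replicate (nat \<bar>k\<bar>) (Gen_a, 0 \<le> k)) []"
        by (simp add: int_pow one word_class_eq_iff)
      from word_eq_imp_polygon_act_cong[OF this, of 0] show "int n dvd k"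
        by (simp add: act_int_pow cong_0_iff del: foldr_replicate)
    next
      assume "int n dvd k"
      then obtain q where "k = int n * q" by (rule dvdE)
      then have "a [^]\<^bsub>D\<^esub> k = (a [^]\<^bsub>D\<^esub> int n) [^]\<^bsub>D\<^esub> q"
        using a_closed by (simp add: int_pow_pow)
      also have "\<dots> = \<one>\<^bsub>D\<^esub>"
        by (simp add: int_pow_int a_pow_n)
      finally show "a [^]\<^bsub>D\<^esub> k = \<one>\<^bsub>D\<^esub>" .
    qed
    show "b \<noteq> a [^]\<^bsub>D\<^esub> k" for k :: int
    proof
      assume "b = a [^]\<^bsub>D\<^esub> k"
      then have eq: "word_eq (dihedral_rels n) [(Gen_b, True)]
          (replicate (nat \<bar>k\<bar>) (Gen_a, 0 \<le> k))"
        by (simp add: int_pow b word_class_eq_iff)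
      have "int n dvd - k" "int n dvd - 2 - k"
        using word_eq_imp_polygon_act_cong[OF eq, of 0] word_eq_imp_polygon_act_cong[OF eq, of 1]
        by (simp_all add: act_int_pow cong_iff_dvd_diff del: foldr_replicate)
      then have "int n dvd (- k) - (- 2 - k)"
        by (rule dvd_diff)
      then have "int n dvd 2" by simp
      then show False
        using assms by (auto dest: zdvd_imp_le)
    qed
    have "?cl w \<in> generate D {a, b}" for w
    proof (induction w)
      case Nil
      show ?case by (simp add: one[symmetric] generate.one)
    next
      case (Cons l w)
      obtain z s where l: "l = (z, s)" by (cases l)
      have "?cl [l] \<in> generate D {a, b}"
        by (cases z; cases s) (auto simp: l inv_letter a b intro: generate.incl generate.inv)
      with Cons show ?case
        using generate.eng[of "?cl [l]" D _ "?cl w"] by (simp add: mult)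
    qed
    then have "carrier D \<subseteq> generate D {a, b}"
      unfolding carrier by blast
    then show "carrier D = generate D {a, b}"
      using generate_incl[of "{a, b}"] a_closed b_closed by blast
  qed (rule a_closed b_closed bb conj)+
  then show ?thesis
    by (simp add: D_def a_def b_def)
qed

theorem theorem3p4:
  fixes n :: nat and H :: "dihedral_gen word set set" and g :: "dihedral_gen word set"
  defines "D \<equiv> dihedral n" and "a \<equiv> dihedral_a n" and "b \<equiv> dihedral_b n"
  assumes "n \<ge> 8" and "even n"
    and "subgroup H D"
    and "g \<in> rel_commutators H D"
  shows "(H = generate D {a} \<longrightarrow>
           Digraph_Component.connected (Delta H D g) \<and> diam (Delta H D g) = 2)
    \<and> (\<forall>r < n div 2. H = generate D {a [^]\<^bsub>D\<^esub> (n div 2), a [^]\<^bsub>D\<^esub> r \<otimes>\<^bsub>D\<^esub> b} \<longrightarrow>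
           (g = \<one>\<^bsub>D\<^esub> \<longrightarrow>
              Digraph_Component.connected (Delta H D g) \<and> diam (Delta H D g) = 2) \<and>
           (g \<noteq> \<one>\<^bsub>D\<^esub> \<longrightarrow> \<not> Digraph_Component.connected (Delta H D g)))
    \<and> (\<forall>r \<in> {1..n}. H = generate D {a [^]\<^bsub>D\<^esub> r \<otimes>\<^bsub>D\<^esub> b} \<longrightarrow>
           \<not> Digraph_Component.connected (Delta H D g))"
proof -
  interpret D: dihedral_group D a b "int n"
    unfolding D_def a_def b_def by (rule dihedral_group_dihedral) (use assms(4) in simp)
  obtain m where m: "n = 2 * m"
    using \<open>even n\<close> by (rule evenE)
  have n_not_dvd_2: "\<not> int n dvd 2"
    using \<open>n \<ge> 8\<close> by (auto dest: zdvd_imp_le)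
  have pow: "a [^]\<^bsub>D\<^esub> k = D.rot (int k)" for k :: nat
    by (simp add: D.rot_def int_pow_int)
  have pow_b: "D.rot (int k) \<otimes>\<^bsub>D\<^esub> b = D.ref (int k)" for k :: nat
    by (simp add: D.ref_eq)
  obtain j where j: "g = D.rot (2 * j)"
    using D.rel_commutatorsE[OF assms(7) subgroup.subset[OF assms(6)]] .
  have j_dvd: "g = \<one>\<^bsub>D\<^esub> \<longleftrightarrow> int m dvd j"
    by (simp add: j D.one_eq_rot D.dihedral_eq m)
  show ?thesis
  proof (intro conjI allI ballI impI)
    assume "H = generate D {a}"
    then show "Digraph_Component.connected (Delta H D g)" "diam (Delta H D g) = 2"
      using D.Delta_rotations[of H g] assms(4,7) by (simp_all add: D.generate_a)
  next
    fix r :: nat assume "H = generate D {a [^]\<^bsub>D\<^esub> (n div 2), a [^]\<^bsub>D\<^esub> r \<otimes>\<^bsub>D\<^esub> b}"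
    then have H: "H = D.dihedral_subgroup (int m) (int r)"
      unfolding pow pow_b by (simp add: m D.generate_rot_ref)
    show "Digraph_Component.connected (Delta H D g)" "diam (Delta H D g) = 2" if "g = \<one>\<^bsub>D\<^esub>"
      using D.Delta_Klein_four_one[of "int m" "int r"] assms(4) m that by (simp_all add: H)
    show "\<not> Digraph_Component.connected (Delta H D g)" if "g \<noteq> \<one>\<^bsub>D\<^esub>"
      unfolding H by (rule D.isolated_rotation_not_connected[where j = j])
        (use that n_not_dvd_2 j j_dvd m in auto)
  next
    fix r :: nat assume "H = generate D {a [^]\<^bsub>D\<^esub> r \<otimes>\<^bsub>D\<^esub> b}"
    then have H: "H = D.dihedral_subgroup (int n) (int r)"
      unfolding pow pow_b by (simp add: D.generate_ref)
    \<comment> \<open>Any \<open>j\<close> with \<open>g = rot (2 * j)\<close> works if \<open>g \<noteq> 1\<close>; for \<open>g = 1\<close> the isolated vertex is the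
      central rotation, which is a vertex because it lies outside \<open>H\<close>.\<close>
    obtain i where i: "g = D.rot (2 * i)" "\<not> int n dvd i"
    proof (cases "g = \<one>\<^bsub>D\<^esub>")
      case True
      then have "g = D.rot (2 * int m)"
        by (simp add: D.one_eq_rot D.dihedral_eq m)
      moreover have "\<not> int n dvd int m"
        using m assms(4) by (auto dest: zdvd_imp_le)
      ultimately show ?thesis using that by blast
    next
      case False
      then have "\<not> int n dvd j"
        using j_dvd m by (auto dest: dvd_mult_right)
      then show ?thesis using that j by blast
    qed
    show "\<not> Digraph_Component.connected (Delta H D g)"
      unfolding H by (rule D.isolated_rotation_not_connected[where j = i])
        (use i n_not_dvd_2 in auto)
  qed
qed

end
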